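(* Let $(S,+,\circ)$ be a weak brace. Then the additive structure $(S,+)$ is a Clifford semigroup.
   Context: A semigroup is inverse if each element $a$ has a unique inverse, i.e. a unique $x$ with $axa=a$ and $xax=x$. A Clifford semigroup is an inverse semigroup whose idempotents are central. A weak (left) brace is a non-empty set $S$ with two binary operations $+$ and $\circ$ such that $(S,+)$ and $(S,\circ)$ are both inverse semigroups (not necessarily commutative) and, for all $a,b,c\in S$, $a\circ(b+c)=a\circ b-a+a\circ c$ and $a\circ a^-=-a+a$, where $-a$ is the inverse of $a$ in $(S,+)$, $a^-$ is the inverse of $a$ in $(S,\circ)$, and $\circ$ has higher precedence than $+$. *)

theory Defs
  imports Main
begin

locale semigroup_on =
  fixes S :: "'a set" and mult :: "'a \<Rightarrow> 'a \<Rightarrow> 'a" (infixl "\<cdot>" 70)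
  assumes closed: "\<lbrakk>a \<in> S; b \<in> S\<rbrakk> \<Longrightarrow> a \<cdot> b \<in> S"
    and assoc: "\<lbrakk>a \<in> S; b \<in> S; c \<in> S\<rbrakk> \<Longrightarrow> (a \<cdot> b) \<cdot> c = a \<cdot> (b \<cdot> c)"

definition is_inverse_of :: "'a set \<Rightarrow> ('a \<Rightarrow> 'a \<Rightarrow> 'a) \<Rightarrow> 'a \<Rightarrow> 'a \<Rightarrow> bool" where
  "is_inverse_of S f a x \<longleftrightarrow> x \<in> S \<and> f (f a x) a = a \<and> f (f x a) x = x"

locale inverse_semigroup_on = semigroup_on +
  assumes unique_inverse: "a \<in> S \<Longrightarrow> \<exists>!x. is_inverse_of S (\<cdot>) a x"

(* Meaningful only for elements of an inverse semigroup. *)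
definition the_inverse :: "'a set \<Rightarrow> ('a \<Rightarrow> 'a \<Rightarrow> 'a) \<Rightarrow> 'a \<Rightarrow> 'a" where
  "the_inverse S f a = (THE x. is_inverse_of S f a x)"

lemma (in inverse_semigroup_on) is_inverse_of_the_inverse:
  "a \<in> S \<Longrightarrow> is_inverse_of S (\<cdot>) a (the_inverse S (\<cdot>) a)"
  unfolding the_inverse_def by (rule theI') (rule unique_inverse)

locale clifford_semigroup_on = inverse_semigroup_on +
  assumes idempotents_central: "\<lbrakk>e \<in> S; e \<cdot> e = e; a \<in> S\<rbrakk> \<Longrightarrow> e \<cdot> a = a \<cdot> e"

locale weak_brace =
  fixes S :: "'a set"
    and add :: "'a \<Rightarrow> 'a \<Rightarrow> 'a" (infixl "\<oplus>" 65)
    and circ :: "'a \<Rightarrow> 'a \<Rightarrow> 'a" (infixl "\<odot>" 70)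
  assumes nonempty: "S \<noteq> {}"
    and add_inverse_semigroup: "inverse_semigroup_on S (\<oplus>)"
    and circ_inverse_semigroup: "inverse_semigroup_on S (\<odot>)"
    and circ_add: "\<lbrakk>a \<in> S; b \<in> S; c \<in> S\<rbrakk> \<Longrightarrow>
      a \<odot> (b \<oplus> c) = a \<odot> b \<oplus> the_inverse S (\<oplus>) a \<oplus> a \<odot> c"
    and circ_inverse: "a \<in> S \<Longrightarrow>
      a \<odot> the_inverse S (\<odot>) a = the_inverse S (\<oplus>) a \<oplus> a"

end

theory Submission
  imports Defs
begin

text \<open>
  An inverse semigroup is Clifford as soon as the idempotents \<open>a - a\<close> and \<open>- a + a\<close> agree for
  every \<open>a\<close> (lemma \<open>clifford_if_left_eq_right\<close>).
  In a weak brace the two operations have the same idempotents, because \<open>a \<circ> a\<^sup>- = - a + a\<close>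
  reads \<open>e \<circ> e\<^sup>- = e\<close> for an additive idempotent \<open>e\<close> and \<open>e = - e + e\<close> for a multiplicative
  one.  This is used to see that an idempotent \<open>e\<close>
  satisfies \<open>e + e \<circ> b = e \<circ> b\<close>, hence \<open>e \<circ> (e + b) = e \<circ> b\<close>.  With \<open>e = a\<^sup>- \<circ> a\<close> one gets
  \<open>(a - a) + a \<circ> b = a \<circ> (e + b) = a \<circ> (e \<circ> (e + b)) = a \<circ> (e \<circ> b) = a \<circ> b\<close>:
  the idempotent \<open>a - a\<close> is a left identity for every \<open>a \<circ> b\<close>.
  The choice \<open>b = a\<^sup>-\<close> shows that \<open>- a + a\<close> lies below \<open>a - a\<close> in the semilattice of additive
  idempotents.  Replacing \<open>a\<close> by \<open>- a\<close> exchanges the two idempotents, so they are equal.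
\<close>

section \<open>Inverse and Clifford semigroups\<close>

context inverse_semigroup_on
begin

abbreviation inv :: "'a \<Rightarrow> 'a" where
  "inv a \<equiv> the_inverse S (\<cdot>) a"

lemma inv_closed: "a \<in> S \<Longrightarrow> inv a \<in> S"
  and mult_inv_mult: "a \<in> S \<Longrightarrow> a \<cdot> inv a \<cdot> a = a"
  and inv_mult_inv: "a \<in> S \<Longrightarrow> inv a \<cdot> a \<cdot> inv a = inv a"
  using is_inverse_of_the_inverse unfolding is_inverse_of_def by blast+

lemma inv_eqI:
  assumes "a \<in> S" "x \<in> S" "a \<cdot> x \<cdot> a = a" "x \<cdot> a \<cdot> x = x"
  shows "inv a = x"
  using assms unique_inverse is_inverse_of_the_inverse unfolding is_inverse_of_def by metis

lemma inv_inv: "a \<in> S \<Longrightarrow> inv (inv a) = a"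
  by (simp add: inv_eqI inv_closed mult_inv_mult inv_mult_inv)

lemma inv_idempotent: "e \<in> S \<Longrightarrow> e \<cdot> e = e \<Longrightarrow> inv e = e"
  by (simp add: inv_eqI)

lemma mult_inv_idempotent: "a \<in> S \<Longrightarrow> (a \<cdot> inv a) \<cdot> (a \<cdot> inv a) = a \<cdot> inv a"
  by (metis assoc closed inv_closed mult_inv_mult)

lemma inv_mult_idempotent: "a \<in> S \<Longrightarrow> (inv a \<cdot> a) \<cdot> (inv a \<cdot> a) = inv a \<cdot> a"
  by (metis assoc closed inv_closed mult_inv_mult)

text \<open>
  If \<open>x\<close> is the inverse of \<open>e \<cdot> f\<close>, then so is \<open>f \<cdot> x \<cdot> e\<close>, which is idempotent; hence
  \<open>x\<close> is idempotent, and so is its inverse \<open>e \<cdot> f\<close>.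
\<close>
lemma idempotent_mult:
  assumes e: "e \<in> S" "e \<cdot> e = e" and f: "f \<in> S" "f \<cdot> f = f"
  shows "(e \<cdot> f) \<cdot> (e \<cdot> f) = e \<cdot> f"
proof -
  define x where "x = inv (e \<cdot> f)"
  have ef: "e \<cdot> f \<in> S" and x: "x \<in> S"
    using e f by (simp_all add: x_def closed inv_closed)
  have ee: "e \<cdot> (e \<cdot> z) = e \<cdot> z" and ff: "f \<cdot> (f \<cdot> z) = f \<cdot> z" if "z \<in> S" for z
    using that e f by (metis assoc)+
  have 1: "e \<cdot> (f \<cdot> (x \<cdot> (e \<cdot> f))) = e \<cdot> f"
    using mult_inv_mult[OF ef] e f x by (simp add: x_def[symmetric] assoc closed)
  have xefx: "x \<cdot> (e \<cdot> (f \<cdot> x)) = x"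
    using inv_mult_inv[OF ef] e f x by (simp add: x_def[symmetric] assoc closed)
  have 2: "x \<cdot> (e \<cdot> (f \<cdot> (x \<cdot> e))) = x \<cdot> e"
    using arg_cong[OF xefx, of "\<lambda>t. t \<cdot> e"] e f x by (simp add: assoc closed)
  have "inv (e \<cdot> f) = f \<cdot> (x \<cdot> e)"
    by (rule inv_eqI) (use e f x 1 2 in \<open>simp_all add: assoc closed ee ff\<close>)
  then have x_eq: "x = f \<cdot> (x \<cdot> e)"
    by (simp add: x_def)
  have "f \<cdot> (x \<cdot> e) \<cdot> (f \<cdot> (x \<cdot> e)) = f \<cdot> (x \<cdot> e)"
    using e f x 2 by (simp add: assoc closed)
  then have "x \<cdot> x = x"
    by (simp only: x_eq[symmetric])
  then have "e \<cdot> f = x"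
    using inv_idempotent[OF x] inv_inv[OF ef] by (simp add: x_def)
  then show ?thesis
    using \<open>x \<cdot> x = x\<close> by simp
qed

text \<open>The idempotent \<open>e \<cdot> f\<close> has both itself and \<open>f \<cdot> e\<close> as inverses.\<close>
lemma idempotents_commute:
  assumes e: "e \<in> S" "e \<cdot> e = e" and f: "f \<in> S" "f \<cdot> f = f"
  shows "e \<cdot> f = f \<cdot> e"
proof -
  have ee: "e \<cdot> (e \<cdot> z) = e \<cdot> z" and ff: "f \<cdot> (f \<cdot> z) = f \<cdot> z" if "z \<in> S" for z
    using that e f by (metis assoc)+
  have efef: "e \<cdot> (f \<cdot> (e \<cdot> f)) = e \<cdot> f" and fefe: "f \<cdot> (e \<cdot> (f \<cdot> e)) = f \<cdot> e"
    using idempotent_mult[OF e f] idempotent_mult[OF f e] e f by (simp_all add: assoc closed)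
  have "inv (e \<cdot> f) = f \<cdot> e"
    by (rule inv_eqI) (use e f efef fefe in \<open>simp_all add: assoc closed ee ff\<close>)
  moreover have "inv (e \<cdot> f) = e \<cdot> f"
    using e f by (simp add: inv_idempotent idempotent_mult closed)
  ultimately show ?thesis by simp
qed

lemma inv_mult:
  assumes a: "a \<in> S" and b: "b \<in> S"
  shows "inv (a \<cdot> b) = inv b \<cdot> inv a"
proof -
  note S = a b inv_closed[OF a] inv_closed[OF b]
  have comm: "(b \<cdot> inv b) \<cdot> (inv a \<cdot> a) = (inv a \<cdot> a) \<cdot> (b \<cdot> inv b)"
    using S by (intro idempotents_commute) (simp_all add: closed mult_inv_idempotent inv_mult_idempotent)
  have "(a \<cdot> b) \<cdot> (inv b \<cdot> inv a) \<cdot> (a \<cdot> b) = a \<cdot> ((b \<cdot> inv b) \<cdot> (inv a \<cdot> a)) \<cdot> b"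
    using S by (simp add: assoc closed)
  also have "\<dots> = (a \<cdot> inv a \<cdot> a) \<cdot> (b \<cdot> inv b \<cdot> b)"
    unfolding comm using S by (simp add: assoc closed)
  finally have 1: "(a \<cdot> b) \<cdot> (inv b \<cdot> inv a) \<cdot> (a \<cdot> b) = a \<cdot> b"
    using S by (simp add: mult_inv_mult)
  have "(inv b \<cdot> inv a) \<cdot> (a \<cdot> b) \<cdot> (inv b \<cdot> inv a) = inv b \<cdot> ((inv a \<cdot> a) \<cdot> (b \<cdot> inv b)) \<cdot> inv a"
    using S by (simp add: assoc closed)
  also have "\<dots> = (inv b \<cdot> b \<cdot> inv b) \<cdot> (inv a \<cdot> a \<cdot> inv a)"
    unfolding comm[symmetric] using S by (simp add: assoc closed)
  finally have 2: "(inv b \<cdot> inv a) \<cdot> (a \<cdot> b) \<cdot> (inv b \<cdot> inv a) = inv b \<cdot> inv a"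
    using S by (simp add: inv_mult_inv)
  show ?thesis
    using S 1 2 by (intro inv_eqI) (simp_all add: closed)
qed

text \<open>
  The hypothesis for \<open>e \<cdot> a\<close>, with \<open>e\<close> idempotent, says that conjugating \<open>e\<close> by \<open>a\<close> gives
  \<open>e \<cdot> (a \<cdot> inv a)\<close>; multiplying this by \<open>a\<close> on the left yields \<open>e \<cdot> a = a \<cdot> e\<close>.
\<close>
lemma clifford_if_left_eq_right:
  assumes eq: "\<And>a. a \<in> S \<Longrightarrow> a \<cdot> inv a = inv a \<cdot> a"
  shows "clifford_semigroup_on S (\<cdot>)"
proof unfold_locales
  fix e a
  assume e: "e \<in> S" "e \<cdot> e = e" and a: "a \<in> S"
  define k where "k = a \<cdot> inv a"
  note S = e(1) a inv_closed[OF a]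
  have k: "k \<in> S" "k \<cdot> k = k" "k \<cdot> a = a"
    using S by (simp_all add: k_def closed mult_inv_idempotent mult_inv_mult)
  have "a \<cdot> k = a \<cdot> (inv a \<cdot> a)"
    by (simp only: k_def eq[OF a])
  then have ak: "a \<cdot> k = a"
    using S by (simp add: assoc[symmetric] mult_inv_mult)
  have ek: "e \<cdot> k = k \<cdot> e"
    using e k idempotents_commute by blast
  have inv_ea: "inv (e \<cdot> a) = inv a \<cdot> e"
    using e a by (simp add: inv_mult inv_idempotent)
  have "(e \<cdot> a) \<cdot> (inv a \<cdot> e) = e \<cdot> (k \<cdot> e)"
    using S by (simp add: k_def assoc closed)
  also have "\<dots> = e \<cdot> k"
    using e k ek by (metis assoc)
  finally have L: "(e \<cdot> a) \<cdot> inv (e \<cdot> a) = e \<cdot> k"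
    by (simp add: inv_ea)
  have "inv (e \<cdot> a) \<cdot> (e \<cdot> a) = inv a \<cdot> ((e \<cdot> e) \<cdot> a)"
    unfolding inv_ea using S by (simp add: assoc closed)
  then have conj: "inv a \<cdot> (e \<cdot> a) = e \<cdot> k"
    using L eq[of "e \<cdot> a"] e S by (simp add: closed)
  have "e \<cdot> a = e \<cdot> (k \<cdot> a)"
    by (simp add: k)
  also have "\<dots> = (k \<cdot> e) \<cdot> a"
    using assoc[OF e(1) k(1) a] by (simp only: ek)
  also have "\<dots> = a \<cdot> (inv a \<cdot> (e \<cdot> a))"
    using S by (simp add: k_def assoc closed)
  also have "\<dots> = a \<cdot> (k \<cdot> e)"
    by (simp add: conj ek)
  also have "\<dots> = a \<cdot> e"
    using e k ak a by (simp add: assoc[symmetric])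
  finally show "e \<cdot> a = a \<cdot> e" .
qed

end

section \<open>Idempotents of a weak brace\<close>

context weak_brace
begin

interpretation add: inverse_semigroup_on S "(\<oplus>)"
  by (rule add_inverse_semigroup)

interpretation circ: inverse_semigroup_on S "(\<odot>)"
  by (rule circ_inverse_semigroup)

lemma idempotent_add_iff_circ:
  assumes e: "e \<in> S"
  shows "e \<oplus> e = e \<longleftrightarrow> e \<odot> e = e"
proof
  assume "e \<oplus> e = e"
  then have "e \<odot> circ.inv e = e"
    using e by (simp add: circ_inverse add.inv_idempotent)
  then show "e \<odot> e = e"
    using circ.mult_inv_idempotent[OF e] by simp
next
  assume "e \<odot> e = e"
  then have "add.inv e \<oplus> e = e"
    using e circ_inverse[OF e] by (simp add: circ.inv_idempotent)
  then show "e \<oplus> e = e"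
    using add.inv_mult_idempotent[OF e] by simp
qed

text \<open>
  For an idempotent \<open>k\<close> in place of \<open>b\<close>, expanding \<open>e \<odot> (k \<oplus> k)\<close> gives the claim, because
  \<open>e \<odot> k\<close> is again an idempotent of both operations.  The general case reduces to
  \<open>k = b - b\<close> by expanding \<open>e \<odot> b = e \<odot> (k \<oplus> b)\<close>.
\<close>
lemma idempotent_add_circ:
  assumes e: "e \<in> S" "e \<oplus> e = e" and b: "b \<in> S"
  shows "e \<oplus> e \<odot> b = e \<odot> b"
proof -
  define k where "k = b \<oplus> add.inv b"
  have k: "k \<in> S" "k \<oplus> k = k" "k \<oplus> b = b"
    using b by (simp_all add: k_def add.closed add.inv_closed add.mult_inv_idempotent add.mult_inv_mult)
  have expand: "e \<odot> (c \<oplus> d) = e \<odot> c \<oplus> e \<oplus> e \<odot> d" if "c \<in> S" "d \<in> S" for c d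
    using circ_add[OF e(1) that] e by (simp add: add.inv_idempotent)
  have eb: "e \<odot> b \<in> S" and ek: "e \<odot> k \<in> S"
    using e b k by (simp_all add: circ.closed)
  have "e \<odot> k \<odot> (e \<odot> k) = e \<odot> k"
    using e k by (intro circ.idempotent_mult) (simp_all add: idempotent_add_iff_circ[symmetric])
  then have ek_idem: "e \<odot> k \<oplus> e \<odot> k = e \<odot> k"
    using ek idempotent_add_iff_circ by blast
  then have comm: "e \<odot> k \<oplus> e = e \<oplus> e \<odot> k"
    using e ek add.idempotents_commute by blast
  have "e \<odot> k = e \<odot> k \<oplus> e \<oplus> e \<odot> k"
    using expand[OF k(1) k(1)] unfolding k(2) .
  also have "\<dots> = e \<oplus> e \<odot> k"
    unfolding comm using e ek ek_idem by (simp add: add.assoc)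
  finally have absorb: "e \<oplus> e \<odot> k = e \<odot> k" by simp
  have eb_eq: "e \<odot> b = e \<odot> k \<oplus> e \<odot> b"
    using expand[OF k(1) b] unfolding k(3) comm absorb .
  have "e \<oplus> e \<odot> b = e \<oplus> (e \<odot> k \<oplus> e \<odot> b)"
    by (simp only: eb_eq[symmetric])
  also have "\<dots> = e \<odot> k \<oplus> e \<odot> b"
    using e ek eb absorb by (simp add: add.assoc[symmetric])
  finally show ?thesis
    by (simp only: eb_eq[symmetric])
qed

text \<open>
  Expanding \<open>a \<odot> (f \<oplus> b)\<close> for \<open>f = a\<^sup>- \<odot> a\<close> produces the left-hand side, since \<open>a \<odot> f = a\<close>;
  for the same reason \<open>f \<oplus> b\<close> may be replaced there by \<open>f \<odot> (f \<oplus> b) = f \<odot> b\<close>.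
\<close>
lemma add_inv_add_circ:
  assumes a: "a \<in> S" and b: "b \<in> S"
  shows "a \<oplus> add.inv a \<oplus> a \<odot> b = a \<odot> b"
proof -
  define f where "f = circ.inv a \<odot> a"
  have f: "f \<in> S" "f \<odot> f = f"
    using a by (simp_all add: f_def circ.closed circ.inv_closed circ.inv_mult_idempotent)
  have af: "a \<odot> f = a"
    using a by (simp add: f_def circ.assoc[symmetric] circ.inv_closed circ.mult_inv_mult)
  have f_add: "f \<oplus> f = f"
    using f idempotent_add_iff_circ by blast
  have "f \<odot> (f \<oplus> b) = f \<odot> f \<oplus> f \<oplus> f \<odot> b"
    using circ_add[OF f(1) f(1) b] f f_add by (simp add: add.inv_idempotent)
  also have "\<dots> = f \<odot> b"
    using f f_add b by (simp add: idempotent_add_circ)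
  finally have ffb: "f \<odot> (f \<oplus> b) = f \<odot> b" .
  have "a \<oplus> add.inv a \<oplus> a \<odot> b = a \<odot> (f \<oplus> b)"
    using circ_add[OF a f(1) b] af by simp
  also have "\<dots> = a \<odot> (f \<odot> (f \<oplus> b))"
    using a b f af by (simp add: circ.assoc[symmetric] add.closed)
  also have "\<dots> = a \<odot> b"
    using a b f af ffb by (simp add: circ.assoc[symmetric])
  finally show ?thesis .
qed

text \<open>
  Multiplying \<open>a\<close> by \<open>a\<^sup>-\<close> shows that \<open>- a + a\<close> is below \<open>a - a\<close>; the same for \<open>- a\<close> is the
  reverse inequality.
\<close>
lemma add_inv_eq_inv_add:
  assumes a: "a \<in> S"
  shows "a \<oplus> add.inv a = add.inv a \<oplus> a"
proof -
  have below: "x \<oplus> add.inv x \<oplus> (add.inv x \<oplus> x) = add.inv x \<oplus> x" if "x \<in> S" for x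
    using add_inv_add_circ[OF that circ.inv_closed[OF that]] circ_inverse[OF that] by simp
  have "add.inv a \<oplus> a \<oplus> (a \<oplus> add.inv a) = a \<oplus> add.inv a"
    using below[of "add.inv a"] a by (simp add: add.inv_inv add.inv_closed)
  moreover have "add.inv a \<oplus> a \<oplus> (a \<oplus> add.inv a) = a \<oplus> add.inv a \<oplus> (add.inv a \<oplus> a)"
    using a by (intro add.idempotents_commute)
      (simp_all add: add.closed add.inv_closed add.mult_inv_idempotent add.inv_mult_idempotent)
  ultimately show ?thesis
    using below[OF a] by simp
qed

lemma add_clifford: "clifford_semigroup_on S (\<oplus>)"
  by (rule add.clifford_if_left_eq_right) (rule add_inv_eq_inv_add)

end

theorem theorem10:
  fixes S :: "'a set" and add circ :: "'a \<Rightarrow> 'a \<Rightarrow> 'a"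
  assumes "weak_brace S add circ"
  shows "clifford_semigroup_on S add"
  using assms by (rule weak_brace.add_clifford)

end
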